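(* Let $n\ge 3$ and let $M_{n,1}=\{0,x_1,a_1,\dots,a_n\}$ be a set of $n+2$ distinct elements with a commutative multiplication such that $0x=0$ for all $x$, $a_1x_1=0$, and $a_ia_j=0$ for all $i\neq j$. Suppose that the subset $M_n=\{0,a_1,\dots,a_n\}$ is closed under the multiplication and is a zero-divisor semigroup with $\Gamma(M_n)\cong K_n$. Assume further that $x_1^2=0$. Then $M_{n,1}$ is a zero-divisor semigroup whose zero-divisor graph is $K_n+1$ (with end vertex $x_1$) if and only if the following conditions hold: (1) $a_1^2=0$; (2) $a_ix_1=a_1$ for all $i\ge 2$; (3) for all $i\ge 2$, $a_i^2=0$ or $a_i^2=a_1$. Moreover, in this situation (commutative multiplications on $M_{n,1}$ such that $0x=0$ for all $x$, $a_1x_1=0$, $a_ia_j=0$ for all $i\neq j$, the subset $M_n$ is closed under the multiplication and is a zero-divisor semigroup with $\Gamma(M_n)\cong K_n$, and $x_1^2=0$, making $M_{n,1}$ a zero-divisor semigroup with graph $K_n+1$) there are, up to isomorphism, exactly $n$ commutative semigroups.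
   Context: All semigroups are commutative, written multiplicatively, with a zero element $0$ satisfying $0x=0$ for all $x$. An element $x$ of such a semigroup $S$ is a zero-divisor if $xy=0$ for some nonzero $y\in S$. A zero-divisor semigroup is a commutative semigroup with zero all of whose elements are zero-divisors. For a zero-divisor semigroup $S$, its zero-divisor graph $\Gamma(S)$ is the simple undirected graph with vertex set $S\setminus\{0\}$ in which distinct vertices $x\neq y$ are joined by an edge exactly when $xy=0$. $K_n$ denotes the complete graph on $n$ vertices, and $K_n+1$ denotes $K_n$ together with one end vertex, i.e. $K_n$ with one additional vertex joined to exactly one vertex of $K_n$. In $M_{n,1}$ the end vertex is $x_1$, adjacent to $a_1$. *)

theory Defs
  imports Graph_Theory.Graph_Theory
begin

text \<open>Semigroups are carrier-based: the values of the multiplication outside the carrier are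
  irrelevant. All semigroups are commutative and have a zero element.\<close>

locale comm_semigroup_with_zero =
  fixes S :: "'a set" and mul :: "'a \<Rightarrow> 'a \<Rightarrow> 'a" and zero :: 'a
  assumes closed: "\<lbrakk>x \<in> S; y \<in> S\<rbrakk> \<Longrightarrow> mul x y \<in> S"
    and assoc: "\<lbrakk>x \<in> S; y \<in> S; w \<in> S\<rbrakk> \<Longrightarrow> mul (mul x y) w = mul x (mul y w)"
    and comm: "\<lbrakk>x \<in> S; y \<in> S\<rbrakk> \<Longrightarrow> mul x y = mul y x"
    and zero_closed: "zero \<in> S"
    and zero_mult: "x \<in> S \<Longrightarrow> mul zero x = zero"

definition zero_divisor :: "'a set \<Rightarrow> ('a \<Rightarrow> 'a \<Rightarrow> 'a) \<Rightarrow> 'a \<Rightarrow> 'a \<Rightarrow> bool" where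
  "zero_divisor S mul zero x \<longleftrightarrow> x \<in> S \<and> (\<exists>y\<in>S. y \<noteq> zero \<and> mul x y = zero)"

definition zero_divisor_semigroup :: "'a set \<Rightarrow> ('a \<Rightarrow> 'a \<Rightarrow> 'a) \<Rightarrow> 'a \<Rightarrow> bool" where
  "zero_divisor_semigroup S mul zero \<longleftrightarrow>
     comm_semigroup_with_zero S mul zero \<and> (\<forall>x\<in>S. zero_divisor S mul zero x)"

text \<open>Undirected graphs are represented, as usual in \<open>Graph_Theory\<close>, by symmetric
  digraphs.\<close>

definition zero_divisor_graph :: "'a set \<Rightarrow> ('a \<Rightarrow> 'a \<Rightarrow> 'a) \<Rightarrow> 'a \<Rightarrow> ('a, 'a \<times> 'a) pre_digraph" where
  "zero_divisor_graph S mul zero = with_proj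
     \<lparr> pverts = S - {zero},
       parcs = {(x, y). x \<in> S - {zero} \<and> y \<in> S - {zero} \<and> x \<noteq> y \<and> mul x y = zero} \<rparr>"

text \<open>The graph \<open>G\<close> is \<open>K\<^sub>n + 1\<close> with end vertex \<open>e\<close>.\<close>

definition complete_plus_end :: "nat \<Rightarrow> ('a, 'b) pre_digraph \<Rightarrow> 'a \<Rightarrow> bool" where
  "complete_plus_end n G e \<longleftrightarrow>
     graph G \<and> e \<in> verts G \<and> K\<^bsub>n\<^esub> (G \<restriction> (verts G - {e})) \<and>
     (\<exists>!v. v \<in> verts G \<and> e \<rightarrow>\<^bsub>G\<^esub> v)"

text \<open>A bijection compatible with the multiplications automatically preserves the zero element.\<close>

definition semigroup_isomorphic ::
    "'a set \<Rightarrow> ('a \<Rightarrow> 'a \<Rightarrow> 'a) \<Rightarrow> 'b set \<Rightarrow> ('b \<Rightarrow> 'b \<Rightarrow> 'b) \<Rightarrow> bool" where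
  "semigroup_isomorphic S mul T mul' \<longleftrightarrow>
     (\<exists>f. bij_betw f S T \<and> (\<forall>x\<in>S. \<forall>y\<in>S. f (mul x y) = mul' (f x) (f y)))"

text \<open>The sets \<open>M\<^sub>n = {0, a\<^sub>1, \<dots>, a\<^sub>n}\<close> and \<open>M\<^sub>n\<^sub>,\<^sub>1 = {0, x\<^sub>1, a\<^sub>1, \<dots>, a\<^sub>n}\<close>.\<close>

definition M_core :: "nat \<Rightarrow> 'a \<Rightarrow> (nat \<Rightarrow> 'a) \<Rightarrow> 'a set" where
  "M_core n zero a = insert zero (a ` {1..n})"

definition M_ext :: "nat \<Rightarrow> 'a \<Rightarrow> 'a \<Rightarrow> (nat \<Rightarrow> 'a) \<Rightarrow> 'a set" where
  "M_ext n zero x1 a = insert zero (insert x1 (a ` {1..n}))"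

text \<open>The standing hypotheses on the multiplication of \<open>M\<^sub>n\<^sub>,\<^sub>1\<close>; associativity is required only
  on \<open>M\<^sub>n\<close>.\<close>

definition M_ext_multiplication ::
    "nat \<Rightarrow> 'a \<Rightarrow> 'a \<Rightarrow> (nat \<Rightarrow> 'a) \<Rightarrow> ('a \<Rightarrow> 'a \<Rightarrow> 'a) \<Rightarrow> bool" where
  "M_ext_multiplication n zero x1 a mul \<longleftrightarrow>
     (\<forall>x\<in>M_ext n zero x1 a. \<forall>y\<in>M_ext n zero x1 a.
        mul x y \<in> M_ext n zero x1 a \<and> mul x y = mul y x) \<and>
     (\<forall>x\<in>M_ext n zero x1 a. mul zero x = zero) \<and>
     mul (a 1) x1 = zero \<and>
     (\<forall>i\<in>{1..n}. \<forall>j\<in>{1..n}. i \<noteq> j \<longrightarrow> mul (a i) (a j) = zero) \<and>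
     (\<forall>x\<in>M_core n zero a. \<forall>y\<in>M_core n zero a. mul x y \<in> M_core n zero a) \<and>
     zero_divisor_semigroup (M_core n zero a) mul zero \<and>
     K\<^bsub>n\<^esub> (zero_divisor_graph (M_core n zero a) mul zero) \<and>
     mul x1 x1 = zero"

end

theory Submission
  imports Defs
begin

text \<open>In a zero-divisor semigroup of the required kind, \<open>a\<^sub>i x\<^sub>1\<close> is nonzero and annihilated by
  \<open>x\<^sub>1\<close>, so it is \<open>a\<^sub>1\<close> or \<open>x\<^sub>1\<close>; the value \<open>x\<^sub>1\<close> is impossible because a third \<open>a\<^sub>j\<close> kills \<open>a\<^sub>i\<close> but not
  \<open>x\<^sub>1\<close>. Conditions (1) and (3) follow by multiplying with \<open>x\<^sub>1\<close>. Conversely, the conditions force every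
  product into \<open>{0, a\<^sub>1}\<close>, which annihilates everything, so all triple products vanish. The
  multiplication is then determined by the set of those \<open>a\<^sub>i\<close> with nonzero square; the size of that
  set, which ranges over \<open>0, \<dots>, n - 1\<close>, is a complete isomorphism invariant.\<close>

section \<open>Preliminaries: counting classes, extending bijections, vanishing triple
  products\<close>

lemma card_quotient_same_value:
  "card (A // {(x, y). x \<in> A \<and> y \<in> A \<and> f x = f y}) = card (f ` A)"
proof -
  let ?R = "{(x, y). x \<in> A \<and> y \<in> A \<and> f x = f y}"
  let ?g = "\<lambda>b. {x \<in> A. f x = b}"
  \<comment> \<open>The classes of the kernel relation of \<open>f\<close> are its fibres. Over
    values taken by \<open>f\<close> the fibres are nonempty, so distinct values have distinct
    fibres. This later turns counting isomorphism classes into counting values of an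
    invariant.\<close>
  have "A // ?R = ?g ` f ` A"
  proof -
    have "?R `` {x} = ?g (f x)" if "x \<in> A" for x
      using that by auto
    then show ?thesis by (simp add: quotient_def image_image UNION_singleton_eq_range)
  qed
  moreover have "inj_on ?g (f ` A)"
    by (rule inj_onI) blast
  ultimately show ?thesis
    by (simp add: card_image)
qed

text \<open>The complements of two equally large subsets of a finite set are again equally large, so
  a bijection between the subsets and one between the complements can be glued. It supplies the
  relabelling of the \<open>a i\<close> that carries nonzero squares to nonzero squares.\<close>

lemma bij_betw_extending_subset:
  assumes "finite B" "P \<subseteq> B" "Q \<subseteq> B" "card P = card Q"
  obtains g where "bij_betw g B B" "\<And>b. b \<in> B \<Longrightarrow> g b \<in> Q \<longleftrightarrow> b \<in> P"
proof -
  have fin: "finite P" "finite Q" using assms finite_subset by auto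
  obtain h where h: "bij_betw h P Q"
    using fin assms(4) finite_same_card_bij by blast
  have "card (B - P) = card (B - Q)"
    using assms fin by (simp add: card_Diff_subset)
  then obtain k where k: "bij_betw k (B - P) (B - Q)"
    using assms(1) finite_same_card_bij[of "B - P" "B - Q"] by auto
  let ?g = "\<lambda>b. if b \<in> P then h b else k b"
  have "bij_betw ?g (P \<union> (B - P)) (Q \<union> (B - Q))"
    using h k by (rule bij_betw_disjoint_Un) auto
  then have "bij_betw ?g B B"
    using assms by (simp add: Un_absorb1)
  moreover have "?g b \<in> Q \<longleftrightarrow> b \<in> P" if "b \<in> B" for b
    using that bij_betwE[OF h] bij_betwE[OF k] by auto
  ultimately show ?thesis by (rule that)
qed

text \<open>Every product is \<open>zero\<close> or \<open>c\<close>, and both annihilate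
  \<open>S\<close>; hence both bracketings of a triple product vanish and associativity is
  automatic. The element \<open>c\<close> itself witnesses that everything is a zero-divisor. The
  lemma serves both M_n and M_{n,1}.\<close>

lemma zero_divisor_semigroup_of_annihilating_products:
  assumes "zero \<in> S" "c \<in> S" "c \<noteq> zero"
    and "\<And>x y. x \<in> S \<Longrightarrow> y \<in> S \<Longrightarrow> mul x y = mul y x"
    and "\<And>x y. x \<in> S \<Longrightarrow> y \<in> S \<Longrightarrow> mul x y \<in> {zero, c}"
    and "\<And>x. x \<in> S \<Longrightarrow> mul zero x = zero"
    and "\<And>x. x \<in> S \<Longrightarrow> mul c x = zero"
  shows "zero_divisor_semigroup S mul zero"
proof -
  have kill: "mul (mul x y) w = zero" if "x \<in> S" "y \<in> S" "w \<in> S" for x y w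
    using assms(5)[OF that(1,2)] assms(6,7)[OF that(3)] by auto
  have closed: "mul x y \<in> S" if "x \<in> S" "y \<in> S" for x y
    using assms(5)[OF that] assms(1,2) by auto
  have "mul x (mul y w) = zero" if "x \<in> S" "y \<in> S" "w \<in> S" for x y w
    using kill[OF that(2,3,1)] assms(4)[OF that(1) closed[OF that(2,3)]] by simp
  then have "comm_semigroup_with_zero S mul zero"
    using assms(1,4,6) closed kill by unfold_locales auto
  moreover have "mul x c = zero" if "x \<in> S" for x
    using assms(2,4,7) that by metis
  ultimately show ?thesis
    using assms(2,3) by (auto simp: zero_divisor_semigroup_def zero_divisor_def)
qed

section \<open>Zero-divisor graphs in elementary terms\<close>

lemma graph_zero_divisor_graph:
  assumes "finite S" "\<And>x y. x \<in> S \<Longrightarrow> y \<in> S \<Longrightarrow> mul x y = mul y x"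
  shows "graph (zero_divisor_graph S mul zero)"
proof -
  have "finite {(x, y). x \<in> S - {zero} \<and> y \<in> S - {zero} \<and> x \<noteq> y \<and> mul x y = zero}"
    by (rule finite_subset[of _ "S \<times> S"]) (use assms in auto)
  then show ?thesis
    using assms unfolding zero_divisor_graph_def
    by unfold_locales
      (auto simp: symmetric_def arc_to_ends_def intro!: symI)
qed

lemma complete_zero_divisor_graph:
  assumes "finite S" "\<And>x y. x \<in> S \<Longrightarrow> y \<in> S \<Longrightarrow> mul x y = mul y x"
  shows "K\<^bsub>n\<^esub> (zero_divisor_graph S mul zero) \<longleftrightarrow>
    card (S - {zero}) = n \<and>
    (\<forall>x\<in>S - {zero}. \<forall>y\<in>S - {zero}. x \<noteq> y \<longrightarrow> mul x y = zero)"
proof -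
  let ?V = "S - {zero}"
  have "{(x, y). x \<in> ?V \<and> y \<in> ?V \<and> x \<noteq> y \<and> mul x y = zero} = {(x, y). (x, y) \<in> ?V \<times> ?V \<and> x \<noteq> y}
      \<longleftrightarrow> (\<forall>x\<in>?V. \<forall>y\<in>?V. x \<noteq> y \<longrightarrow> mul x y = zero)"
    by (simp add: set_eq_iff) blast
  then show ?thesis
    using graph_zero_divisor_graph[of S mul zero, OF assms]
    by (simp add: complete_digraph_def zero_divisor_graph_def)
qed

text \<open>The set \<open>S - {e}\<close> need not be closed under \<open>mul\<close>, but the
  graph only records which products vanish. Deleting a vertex can therefore be treated as shrinking
  the carrier, and the criterion for complete graphs applies to what remains.\<close>

lemma zero_divisor_graph_restrict:
  "zero_divisor_graph S mul zero \<restriction> (verts (zero_divisor_graph S mul zero) - {e})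
     = zero_divisor_graph (S - {e}) mul zero"
  by (auto simp: zero_divisor_graph_def induce_subgraph_def with_proj_def)

lemma complete_plus_end_zero_divisor_graph:
  assumes "finite S" "\<And>x y. x \<in> S \<Longrightarrow> y \<in> S \<Longrightarrow> mul x y = mul y x" "e \<in> S" "e \<noteq> zero"
  shows "complete_plus_end n (zero_divisor_graph S mul zero) e \<longleftrightarrow>
    card (S - {e} - {zero}) = n \<and>
    (\<forall>x\<in>S - {e} - {zero}. \<forall>y\<in>S - {e} - {zero}. x \<noteq> y \<longrightarrow> mul x y = zero) \<and>
    (\<exists>!v. v \<in> S \<and> v \<noteq> zero \<and> v \<noteq> e \<and> mul e v = zero)"
proof -
  have "K\<^bsub>n\<^esub> (zero_divisor_graph (S - {e}) mul zero) \<longleftrightarrow>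
    card (S - {e} - {zero}) = n \<and>
    (\<forall>x\<in>S - {e} - {zero}. \<forall>y\<in>S - {e} - {zero}. x \<noteq> y \<longrightarrow> mul x y = zero)"
    by (rule complete_zero_divisor_graph) (use assms in auto)
  moreover have "v \<in> verts (zero_divisor_graph S mul zero) \<and> e \<rightarrow>\<^bsub>zero_divisor_graph S mul zero\<^esub> v
      \<longleftrightarrow> v \<in> S \<and> v \<noteq> zero \<and> v \<noteq> e \<and> mul e v = zero" for v
    using assms by (auto simp: zero_divisor_graph_def)
  moreover have "e \<in> verts (zero_divisor_graph S mul zero)"
    using assms by (simp add: zero_divisor_graph_def)
  ultimately show ?thesis
    using graph_zero_divisor_graph[of S mul zero, OF assms(1,2)]
    by (simp add: complete_plus_end_def zero_divisor_graph_restrict)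
qed

section \<open>An isomorphism invariant, and the model multiplication\<close>

lemma card_nonzero_squares_invariant:
  assumes "comm_semigroup_with_zero S mul zero" "comm_semigroup_with_zero S mul' zero"
    and "semigroup_isomorphic S mul S mul'"
  shows "card {x \<in> S. mul x x \<noteq> zero} = card {x \<in> S. mul' x x \<noteq> zero}"
proof -
  interpret m: comm_semigroup_with_zero S mul zero by fact
  interpret m': comm_semigroup_with_zero S mul' zero by fact
  obtain f where f: "bij_betw f S S" "\<And>x y. x \<in> S \<Longrightarrow> y \<in> S \<Longrightarrow> f (mul x y) = mul' (f x) (f y)"
    using assms(3) by (auto simp: semigroup_isomorphic_def)
  have fS: "f x \<in> S" if "x \<in> S" for x
    using f(1) that bij_betwE by blast
  \<comment> \<open>Surjectivity gives a preimage \<open>z\<close> of \<open>zero\<close>. Applying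
    \<open>f\<close> to the product of \<open>zero\<close> and \<open>z\<close> then shows that
    \<open>f\<close> fixes \<open>zero\<close>, so vanishing of squares is preserved in both
    directions.\<close>
  obtain z where z: "z \<in> S" "f z = zero"
    using f(1) m.zero_closed by (metis bij_betw_iff_bijections)
  have "f zero = f (mul zero z)"
    using m.zero_mult z by simp
  also have "\<dots> = mul' (f z) (f zero)"
    using f(2) z m.zero_closed m'.comm fS by simp
  also have "\<dots> = zero"
    using z fS m.zero_closed m'.zero_mult by simp
  finally have "f zero = zero" .
  then have zero_iff: "f x = zero \<longleftrightarrow> x = zero" if "x \<in> S" for x
    using f(1) that m.zero_closed by (metis bij_betw_imp_inj_on inj_onD)
  have "mul' (f x) (f x) \<noteq> zero \<longleftrightarrow> mul x x \<noteq> zero" if "x \<in> S" for x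
    using zero_iff[OF m.closed[OF that that]] f(2)[OF that that] by simp
  then have "f ` {x \<in> S. mul x x \<noteq> zero} = {x \<in> S. mul' x x \<noteq> zero}"
    using bij_betw_imp_surj_on[OF f(1)] by (auto simp: image_iff) (metis imageE)
  then show ?thesis
    using f(1) by (metis (no_types, lifting) bij_betw_imp_inj_on card_image inj_on_subset
        mem_Collect_eq subsetI)
qed

text \<open>The normal form of the multiplications to be classified: \<open>e\<close> is the end
  vertex, \<open>c\<close> its neighbour and the only possible nonzero product, \<open>B\<close> the
  vertices not adjacent to \<open>e\<close>, and \<open>P\<close> the free parameter, the set of
  elements with nonzero square.\<close>

definition end_mul :: "'a \<Rightarrow> 'a \<Rightarrow> 'a \<Rightarrow> 'a set \<Rightarrow> 'a set \<Rightarrow> 'a \<Rightarrow> 'a \<Rightarrow> 'a" where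
  "end_mul zero e c B P x y =
     (if x = e \<and> y \<in> B \<or> x \<in> B \<and> y = e \<or> x = y \<and> x \<in> P then c else zero)"

section \<open>The labelled set M_{n,1}, with \<open>a 1\<close> separated from the other
  \<open>a i\<close>\<close>

locale M_ext_elements =
  fixes n :: nat and zero x1 :: 'a and a :: "nat \<Rightarrow> 'a"
  assumes n_ge_3: "n \<ge> 3"
    and inj_a: "inj_on a {1..n}" and zero_notin_a: "zero \<notin> a ` {1..n}"
    and x1_notin_a: "x1 \<notin> a ` {1..n}" and x1_nonzero: "x1 \<noteq> zero"
begin

abbreviation S :: "'a set" where "S \<equiv> M_ext n zero x1 a"
abbreviation B :: "'a set" where "B \<equiv> a ` {2..n}"

lemma a_image: "a ` {1..n} = insert (a 1) B"
proof -
  have "{1..n} = insert 1 {2..n}" using n_ge_3 by auto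
  then show ?thesis by simp
qed

lemma S_eq: "S = {zero, x1, a 1} \<union> B"
  unfolding M_ext_def a_image by auto

lemma core_eq: "M_core n zero a = {zero, a 1} \<union> B"
  unfolding M_core_def a_image by auto

lemma distinct:
  "a 1 \<noteq> zero" "a 1 \<noteq> x1" "x1 \<noteq> zero" "zero \<notin> B" "x1 \<notin> B" "a 1 \<notin> B"
  using n_ge_3 zero_notin_a x1_notin_a x1_nonzero inj_a unfolding a_image
  by (auto dest: inj_onD[OF inj_a])

lemma finite_S: "finite S" by (simp add: M_ext_def)

lemma card_B: "card B = n - 1"
proof -
  have "inj_on a {2..n}" using inj_a by (rule inj_on_subset) auto
  then show ?thesis by (simp add: card_image)
qed

lemma card_a: "card (insert (a 1) B) = n"
  using card_image[OF inj_a] unfolding a_image by simp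

section \<open>Necessity of the conditions\<close>

lemma conditions_necessary:
  assumes M: "M_ext_multiplication n zero x1 a mul"
    and zds: "zero_divisor_semigroup S mul zero"
    and cpe: "complete_plus_end n (zero_divisor_graph S mul zero) x1"
  shows "mul (a 1) (a 1) = zero" "\<forall>i\<in>{2..n}. mul (a i) x1 = a 1"
    "\<forall>i\<in>{2..n}. mul (a i) (a i) = zero \<or> mul (a i) (a i) = a 1"
proof -
  interpret comm_semigroup_with_zero S mul zero
    using zds by (simp add: zero_divisor_semigroup_def)
  have aS: "a i \<in> S" if "i \<in> {1..n}" for i using that by (simp add: M_ext_def)
  have x1S: "x1 \<in> S" and a1S: "a 1 \<in> S" by (simp_all add: S_eq)
  have a1x1: "mul x1 (a 1) = zero"
    using M comm[OF x1S a1S] by (simp add: M_ext_multiplication_def)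
  have x1x1: "mul x1 x1 = zero"
    using M by (simp add: M_ext_multiplication_def)
  have aa: "mul (a i) (a j) = zero" if "i \<in> {1..n}" "j \<in> {1..n}" "i \<noteq> j" for i j
    using M that unfolding M_ext_multiplication_def by blast
  have "\<exists>!v. v \<in> S \<and> v \<noteq> zero \<and> v \<noteq> x1 \<and> mul x1 v = zero"
    using cpe complete_plus_end_zero_divisor_graph[of S mul x1 zero n] finite_S comm x1S x1_nonzero
    by blast
  \<comment> \<open>The end vertex has exactly one neighbour, and \<open>a 1\<close> is one; so the
    annihilator of \<open>x1\<close> is known completely.\<close>
  then have ann: "v \<in> {zero, x1, a 1}" if "v \<in> S" "mul x1 v = zero" for v
    using that a1x1 a1S distinct(1,2) by blast
  have aix1: "mul (a i) x1 = a 1" if i: "i \<in> {2..n}" for i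
  proof -
    have iS: "a i \<in> S" using aS i by auto
    have nz: "mul (a k) x1 \<noteq> zero" if "k \<in> {2..n}" for k
    proof
      assume "mul (a k) x1 = zero"
      then have "a k \<in> {zero, x1, a 1}"
        using ann comm x1S aS that by auto
      moreover have "a k \<in> B" using that by blast
      ultimately show False using distinct by auto
    qed
    \<comment> \<open>Since \<open>x1\<close> squares to \<open>zero\<close>, multiplying
      \<open>mul (a i) x1\<close> once more by \<open>x1\<close> gives \<open>zero\<close>. This
      puts it in the annihilator of \<open>x1\<close>, and \<open>nz\<close> leaves only two
      candidates.\<close>
    have "mul x1 (mul (a i) x1) = zero"
      using assoc[OF iS x1S x1S] comm iS x1S x1x1 closed zero_mult zero_closed by metis
    then have "mul (a i) x1 \<in> {x1, a 1}"
      using ann[of "mul (a i) x1"] closed iS x1S nz[OF i] by blast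
    moreover have "mul (a i) x1 \<noteq> x1"
    proof
      assume *: "mul (a i) x1 = x1"
      \<comment> \<open>Here n \<ge> 3 enters: it provides a second index in \<open>{2..n}\<close>.
        If \<open>a i\<close> fixed \<open>x1\<close>, then \<open>a j\<close> times
        \<open>x1\<close> would equal \<open>(a j)(a i) x1\<close>, which vanishes, contrary to
        \<open>nz\<close> for \<open>j\<close>.\<close>
      obtain j where j: "j \<in> {2..n}" "j \<noteq> i"
      proof (cases "i = 2")
        case True
        then show ?thesis using n_ge_3 that[of 3] by auto
      next
        case False
        then show ?thesis using n_ge_3 that[of 2] by auto
      qed
      have "mul (a j) x1 = mul (mul (a j) (a i)) x1"
        using assoc[of "a j" "a i" x1] aS j i x1S * by auto
      also have "\<dots> = zero"
        using aa[of j i] j i zero_mult x1S by auto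
      finally show False using nz j by blast
    qed
    ultimately show ?thesis by blast
  qed
  then show "\<forall>i\<in>{2..n}. mul (a i) x1 = a 1" by blast
  have two: "2 \<in> {2..n}" "2 \<in> {1..n}" "1 \<in> {1..n}" using n_ge_3 by auto
  \<comment> \<open>One factor \<open>a 1\<close> is written as the product of \<open>a 2\<close>
    and \<open>x1\<close>, so that the vanishing product of \<open>a 1\<close> and
    \<open>a 2\<close> appears.\<close>
  have "mul (a 1) (a 1) = mul (mul (a 1) (a 2)) x1"
    using assoc[OF a1S aS[OF two(2)] x1S] aix1[OF two(1)] by simp
  then show "mul (a 1) (a 1) = zero"
    using aa[of 1 2] two zero_mult x1S by simp
  show "\<forall>i\<in>{2..n}. mul (a i) (a i) = zero \<or> mul (a i) (a i) = a 1"
  proof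
    fix i assume i: "i \<in> {2..n}"
    then have i1: "i \<in> {1..n}" "i \<noteq> 1" by auto
    \<comment> \<open>The square of \<open>a i\<close> will be shown to annihilate
      \<open>x1\<close>, which leaves \<open>zero\<close>, \<open>x1\<close> and \<open>a 1\<close>;
      closure of M_n excludes \<open>x1\<close>.\<close>
    have core: "mul (a i) (a i) \<in> M_core n zero a"
      using M i1 by (auto simp: M_ext_multiplication_def M_core_def)
    have "mul x1 (mul (a i) (a i)) = mul (a i) (mul (a i) x1)"
      using assoc comm closed x1S aS[OF i1(1)] by metis
    also have "\<dots> = zero"
      using aix1[OF i] aa[of i 1] i1 two by simp
    finally have "mul (a i) (a i) \<in> {zero, x1, a 1}"
      using ann closed aS[OF i1(1)] by blast
    moreover have "mul (a i) (a i) \<noteq> x1"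
      using core distinct by (auto simp: core_eq)
    ultimately show "mul (a i) (a i) = zero \<or> mul (a i) (a i) = a 1" by blast
  qed
qed

section \<open>The normal form of the multiplication, and sufficiency of the conditions\<close>

definition agrees :: "('a \<Rightarrow> 'a \<Rightarrow> 'a) \<Rightarrow> 'a set \<Rightarrow> bool" where
  "agrees mul P \<longleftrightarrow> P \<subseteq> B \<and> (\<forall>x\<in>S. \<forall>y\<in>S. mul x y = end_mul zero x1 (a 1) B P x y)"

text \<open>The standing hypotheses with (1) and (2) prescribe every product on \<open>S\<close>
  except the squares of elements of \<open>B\<close>. Condition (3) leaves two values for each of
  these, and the set \<open>P\<close> records the choice.\<close>

lemma conditions_imp_agrees:
  assumes M: "M_ext_multiplication n zero x1 a mul"
    and c: "mul (a 1) (a 1) = zero" "\<forall>i\<in>{2..n}. mul (a i) x1 = a 1"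
      "\<forall>i\<in>{2..n}. mul (a i) (a i) = zero \<or> mul (a i) (a i) = a 1"
  shows "agrees mul {b \<in> B. mul b b = a 1}"
proof -
  have comm: "mul x y = mul y x" if "x \<in> S" "y \<in> S" for x y
    using M that unfolding M_ext_multiplication_def by blast
  have z: "mul zero x = zero" if "x \<in> S" for x
    using M that unfolding M_ext_multiplication_def by blast
  then have z': "mul x zero = zero" if "x \<in> S" for x
    using comm[of x zero] that by (simp add: S_eq)
  have x: "mul (a 1) x1 = zero" "mul x1 x1 = zero"
    using M unfolding M_ext_multiplication_def by blast+
  have x': "mul x1 (a 1) = zero"
    using comm[of x1 "a 1"] x by (simp add: S_eq)
  have bx: "mul b x1 = a 1" if "b \<in> B" for b
    using c(2) that by blast
  then have xb: "mul x1 b = a 1" if "b \<in> B" for b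
    using comm[of x1 b] that by (simp add: S_eq)
  have "\<forall>i\<in>{1..n}. \<forall>j\<in>{1..n}. i \<noteq> j \<longrightarrow> mul (a i) (a j) = zero"
    using M unfolding M_ext_multiplication_def by blast
  then have aa: "mul u v = zero" if "u \<in> insert (a 1) B" "v \<in> insert (a 1) B" "u \<noteq> v" for u v
    using that unfolding a_image[symmetric] by auto
  have bb: "mul b b = zero \<or> mul b b = a 1" if "b \<in> B" for b
    using c(3) that by blast
  have "mul u v = end_mul zero x1 (a 1) B {b \<in> B. mul b b = a 1} u v" if "u \<in> S" "v \<in> S" for u v
  proof -
    consider "u = zero" | "v = zero" | "u = x1" "v = x1" | "u = x1" "v = a 1" | "u = a 1" "v = x1"
      | "u = x1" "v \<in> B" | "u \<in> B" "v = x1" | "u = v" "u = a 1" | "u = v" "u \<in> B"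
      | "u \<noteq> v" "u \<in> insert (a 1) B" "v \<in> insert (a 1) B"
      using \<open>u \<in> S\<close> \<open>v \<in> S\<close> unfolding S_eq by blast
    then show ?thesis
    proof cases
      \<comment> \<open>Squares of elements of \<open>B\<close>: the only case that draws on
        condition (3).\<close>
      case 9
      then show ?thesis using bb distinct by (auto simp: end_mul_def)
    next
      case 10
      then show ?thesis using aa distinct by (auto simp: end_mul_def)
    qed (use that z z' x x' bx xb c(1) distinct in \<open>auto simp: end_mul_def\<close>)
  qed
  then show ?thesis by (auto simp: agrees_def)
qed

text \<open>All products lie in \<open>{zero, a 1}\<close> and \<open>a 1\<close> annihilates
  \<open>S\<close>, whatever \<open>P\<close> is; so the criterion for vanishing triple products
  applies to M_{n,1} and to M_n alike.\<close>

lemma agrees_sufficient: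
  assumes "agrees mul P"
  shows "M_ext_multiplication n zero x1 a mul"
    "zero_divisor_semigroup S mul zero"
    "complete_plus_end n (zero_divisor_graph S mul zero) x1"
proof -
  have mul: "mul x y = end_mul zero x1 (a 1) B P x y" if "x \<in> S" "y \<in> S" for x y
    using assms that by (simp add: agrees_def)
  have PB: "P \<subseteq> B" using assms by (simp add: agrees_def)
  have comm: "mul x y = mul y x" if "x \<in> S" "y \<in> S" for x y
    using that mul by (auto simp: end_mul_def)
  have range: "mul x y \<in> {zero, a 1}" if "x \<in> S" "y \<in> S" for x y
    using that mul by (auto simp: end_mul_def)
  have mem: "zero \<in> S" "a 1 \<in> S" "x1 \<in> S" by (auto simp: S_eq)
  have z: "mul zero x = zero" "mul (a 1) x = zero" if "x \<in> S" for x
    using that mem mul distinct PB by (auto simp: end_mul_def)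
  have sub: "M_core n zero a \<subseteq> S" by (auto simp: core_eq S_eq)
  have x1x1: "mul x1 x1 = zero" using mul mem distinct PB by (auto simp: end_mul_def)
  have x1b: "mul x1 b = a 1" if "b \<in> B" for b using mul mem that by (auto simp: end_mul_def S_eq)
  have aa: "mul u v = zero" if "u \<in> insert (a 1) B" "v \<in> insert (a 1) B" "u \<noteq> v" for u v
    using that mul[of u v] distinct by (auto simp: end_mul_def S_eq)
  \<comment> \<open>The graph of M_n and the graph of M_{n,1} without its end vertex have the same
    vertices, so \<open>card_a\<close> and \<open>aa\<close> settle completeness for both.\<close>
  have core_minus: "M_core n zero a - {zero} = insert (a 1) B"
    and S_minus: "S - {x1} - {zero} = insert (a 1) B"
    using distinct by (auto simp: core_eq S_eq)
  show "zero_divisor_semigroup S mul zero"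
    by (rule zero_divisor_semigroup_of_annihilating_products[of _ _ "a 1"])
      (use mem distinct comm range z in auto)
  have "zero_divisor_semigroup (M_core n zero a) mul zero"
  proof (rule zero_divisor_semigroup_of_annihilating_products[of _ _ "a 1"])
    show "zero \<in> M_core n zero a" "a 1 \<in> M_core n zero a" by (simp_all add: core_eq)
    fix x y assume "x \<in> M_core n zero a" "y \<in> M_core n zero a"
    then have "x \<in> S" "y \<in> S" using sub by blast+
    then show "mul x y = mul y x" "mul x y \<in> {zero, a 1}" by (rule comm range)+
  qed (use distinct(1) z sub in \<open>simp_all add: subset_iff\<close>)
  moreover have "K\<^bsub>n\<^esub> (zero_divisor_graph (M_core n zero a) mul zero)"
  proof (subst complete_zero_divisor_graph)
    show "finite (M_core n zero a)" by (simp add: core_eq)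
    show "mul x y = mul y x" if "x \<in> M_core n zero a" "y \<in> M_core n zero a" for x y
      using comm sub that by blast
  qed (use card_a aa core_minus in auto)
  moreover have "mul x y \<in> S" if "x \<in> S" "y \<in> S" for x y
    using range[OF that] mem by auto
  moreover have "mul x y \<in> M_core n zero a" if "x \<in> M_core n zero a" "y \<in> M_core n zero a" for x y
    using range[of x y] sub that by (auto simp: core_eq)
  moreover have "mul (a i) (a j) = zero" if "i \<in> {1..n}" "j \<in> {1..n}" "i \<noteq> j" for i j
    using aa[of "a i" "a j"] that inj_onD[OF inj_a] unfolding a_image[symmetric] by blast
  ultimately show "M_ext_multiplication n zero x1 a mul"
    unfolding M_ext_multiplication_def using comm z mem x1x1 by blast
  \<comment> \<open>Elements of \<open>B\<close> are not adjacent to \<open>x1\<close>, because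
    their product with \<open>x1\<close> is \<open>a 1\<close>, which is nonzero.\<close>
  have "\<exists>!v. v \<in> S \<and> v \<noteq> zero \<and> v \<noteq> x1 \<and> mul x1 v = zero"
  proof (rule ex1I[of _ "a 1"])
    show "a 1 \<in> S \<and> a 1 \<noteq> zero \<and> a 1 \<noteq> x1 \<and> mul x1 (a 1) = zero"
      using mem distinct z comm by metis
    show "v = a 1" if "v \<in> S \<and> v \<noteq> zero \<and> v \<noteq> x1 \<and> mul x1 v = zero" for v
      using that x1b distinct(1) unfolding S_eq by auto
  qed
  then show "complete_plus_end n (zero_divisor_graph S mul zero) x1"
    using complete_plus_end_zero_divisor_graph[of S mul x1 zero n] finite_S comm mem x1_nonzero
      S_minus card_a aa by simp
qed

section \<open>Classification up to isomorphism\<close>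

lemma agrees_nonzero_squares:
  assumes "agrees mul P"
  shows "{x \<in> S. mul x x \<noteq> zero} = P"
proof -
  have P: "P \<subseteq> B" using assms by (simp add: agrees_def)
  have "mul x x \<noteq> zero \<longleftrightarrow> x \<in> P" if "x \<in> S" for x
    using assms that P distinct by (auto simp: agrees_def end_mul_def)
  moreover have "P \<subseteq> S" using P by (auto simp: S_eq)
  ultimately show ?thesis by blast
qed

text \<open>A permutation of \<open>B\<close> taking \<open>P\<close> onto \<open>Q\<close>,
  extended by the identity on \<open>zero\<close>, \<open>x1\<close> and \<open>a 1\<close>, is an
  isomorphism, because it respects every test made by \<open>end_mul\<close>.\<close>

lemma agrees_isomorphic:
  assumes "agrees mul P" "agrees mul' Q" "card P = card Q"
  shows "semigroup_isomorphic S mul S mul'"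
proof -
  have PQ: "P \<subseteq> B" "Q \<subseteq> B" using assms by (auto simp: agrees_def)
  obtain g where g: "bij_betw g B B" "\<And>b. b \<in> B \<Longrightarrow> g b \<in> Q \<longleftrightarrow> b \<in> P"
    using bij_betw_extending_subset[OF _ PQ assms(3)] by auto
  let ?C = "{zero, x1, a 1}"
  let ?f = "\<lambda>x. if x \<in> ?C then id x else g x"
  have "bij_betw ?f (?C \<union> B) (?C \<union> B)"
    using bij_betw_id g(1) by (rule bij_betw_disjoint_Un) (use distinct in auto)
  then have bij: "bij_betw ?f S S" by (simp only: S_eq)
  have gB: "g b \<in> B" if "b \<in> B" for b using that g(1) bij_betwE by blast
  have f: "?f zero = zero" "?f x1 = x1" "?f (a 1) = a 1"
    by simp_all
  have fS: "?f x \<in> S" if "x \<in> S" for x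
    using bij that bij_betwE by blast
  have eq: "?f x = ?f y \<longleftrightarrow> x = y" if "x \<in> S" "y \<in> S" for x y
    using that by (rule inj_on_eq_iff[OF bij_betw_imp_inj_on[OF bij]])
  have fB: "?f x \<in> B \<longleftrightarrow> x \<in> B" and fx1: "?f x = x1 \<longleftrightarrow> x = x1" and fQ: "?f x \<in> Q \<longleftrightarrow> x \<in> P"
    if "x \<in> S" for x
  proof -
    have "?C \<inter> B = {}" using distinct by auto
    moreover have "x \<in> ?C \<or> x \<in> B" using that by (simp only: S_eq Un_iff)
    ultimately consider "x \<in> ?C" "x \<notin> B" | "x \<in> B" "x \<notin> ?C" by blast
    then show "?f x \<in> B \<longleftrightarrow> x \<in> B" "?f x \<in> Q \<longleftrightarrow> x \<in> P" "?f x = x1 \<longleftrightarrow> x = x1"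
      by (cases; use PQ g(2) gB distinct in auto)+
  qed
  have "?f (mul x y) = mul' (?f x) (?f y)" if "x \<in> S" "y \<in> S" for x y
  proof -
    have "mul' (?f x) (?f y) = end_mul zero x1 (a 1) B Q (?f x) (?f y)"
      using assms(2) fS that unfolding agrees_def by blast
    also have "\<dots> = end_mul zero x1 (a 1) B P x y"
      unfolding end_mul_def fB[OF that(1)] fB[OF that(2)] fx1[OF that(1)] fx1[OF that(2)]
        fQ[OF that(1)] eq[OF that] by (rule refl)
    also have "\<dots> = mul x y"
      using assms(1) that by (simp add: agrees_def)
    \<comment> \<open>The product is \<open>zero\<close> or \<open>a 1\<close>, and
      \<open>?f\<close> fixes both.\<close>
    also have "\<dots> = ?f (mul x y)"
      using assms(1) that f by (auto simp: agrees_def end_mul_def)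
    finally show ?thesis by simp
  qed
  with bij show ?thesis unfolding semigroup_isomorphic_def by blast
qed

text \<open>Members of \<open>A\<close> may take arbitrary values outside \<open>S\<close>, but
  isomorphism sees only products on \<open>S\<close>. The number of nonzero squares is constant on
  isomorphism classes and separates them, so the classes correspond to its values.\<close>

lemma card_isomorphism_classes:
  assumes A: "A = {mul. \<exists>P. agrees mul P}"
  shows "card (A // {(m, m'). m \<in> A \<and> m' \<in> A \<and> semigroup_isomorphic S m S m'}) = n"
proof -
  let ?N = "\<lambda>mul. card {x \<in> S. mul x x \<noteq> zero}"
  have "semigroup_isomorphic S m S m' \<longleftrightarrow> ?N m = ?N m'" if "m \<in> A" "m' \<in> A" for m m'
  proof -
    obtain P Q where PQ: "agrees m P" "agrees m' Q" using \<open>m \<in> A\<close> \<open>m' \<in> A\<close> A by auto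
    have "comm_semigroup_with_zero S m zero" "comm_semigroup_with_zero S m' zero"
      using agrees_sufficient(2) PQ by (auto simp: zero_divisor_semigroup_def)
    from card_nonzero_squares_invariant[OF this] agrees_isomorphic[OF PQ] show ?thesis
      unfolding agrees_nonzero_squares[OF PQ(1)] agrees_nonzero_squares[OF PQ(2)] by blast
  qed
  then have "{(m, m'). m \<in> A \<and> m' \<in> A \<and> semigroup_isomorphic S m S m'}
      = {(m, m'). m \<in> A \<and> m' \<in> A \<and> ?N m = ?N m'}" by blast
  \<comment> \<open>The set of elements with nonzero square can be any subset of \<open>B\<close>,
    and \<open>B\<close> has n - 1 elements; the sizes 0 to n - 1 make n values.\<close>
  moreover have "?N ` A = {..<n}"
  proof (intro equalityI subsetI)
    fix k assume "k \<in> ?N ` A"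
    then obtain m where "m \<in> A" "k = ?N m" by blast
    then obtain P where "agrees m P" "k = card P"
      using A agrees_nonzero_squares by auto
    then have "k \<le> card B" by (auto simp: agrees_def intro: card_mono)
    then show "k \<in> {..<n}" using card_B n_ge_3 by simp
  next
    fix k assume "k \<in> {..<n}"
    then have "k \<le> card B" using card_B by simp
    then obtain P where P: "P \<subseteq> B" "card P = k" by (meson obtain_subset_with_card_n)
    then have *: "agrees (end_mul zero x1 (a 1) B P) P" by (simp add: agrees_def)
    have "k = ?N (end_mul zero x1 (a 1) B P)"
      using agrees_nonzero_squares[OF *] P by simp
    moreover have "end_mul zero x1 (a 1) B P \<in> A" using A * by auto
    ultimately show "k \<in> ?N ` A" by (rule image_eqI)
  qed
  ultimately show ?thesis by (simp add: card_quotient_same_value)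
qed

end

theorem theorem3p1:
  fixes n :: nat and zero x1 :: 'a and a :: "nat \<Rightarrow> 'a"
  assumes "n \<ge> 3"
    and "inj_on a {1..n}" and "zero \<notin> a ` {1..n}" and "x1 \<notin> a ` {1..n}" and "x1 \<noteq> zero"
  shows "(\<forall>mul. M_ext_multiplication n zero x1 a mul \<longrightarrow>
            (zero_divisor_semigroup (M_ext n zero x1 a) mul zero \<and>
             complete_plus_end n (zero_divisor_graph (M_ext n zero x1 a) mul zero) x1
             \<longleftrightarrow>
             mul (a 1) (a 1) = zero \<and>
             (\<forall>i\<in>{2..n}. mul (a i) x1 = a 1) \<and>
             (\<forall>i\<in>{2..n}. mul (a i) (a i) = zero \<or> mul (a i) (a i) = a 1)))
       \<and> (let A = {mul. M_ext_multiplication n zero x1 a mul \<and>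
                    zero_divisor_semigroup (M_ext n zero x1 a) mul zero \<and>
                    complete_plus_end n (zero_divisor_graph (M_ext n zero x1 a) mul zero) x1}
          in card (A // {(m, m'). m \<in> A \<and> m' \<in> A \<and>
                 semigroup_isomorphic (M_ext n zero x1 a) m (M_ext n zero x1 a) m'}) = n)"
proof -
  interpret M_ext_elements n zero x1 a by unfold_locales fact+
  let ?C = "\<lambda>mul. mul (a 1) (a 1) = zero \<and> (\<forall>i\<in>{2..n}. mul (a i) x1 = a 1) \<and>
    (\<forall>i\<in>{2..n}. mul (a i) (a i) = zero \<or> mul (a i) (a i) = a 1)"
  let ?G = "\<lambda>mul. zero_divisor_semigroup S mul zero \<and>
    complete_plus_end n (zero_divisor_graph S mul zero) x1"
  have necessary: "?C mul" if "M_ext_multiplication n zero x1 a mul" "?G mul" for mul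
    using conditions_necessary[of mul] that by simp
  have agrees: "\<exists>P. agrees mul P" if "M_ext_multiplication n zero x1 a mul" "?C mul" for mul
    using conditions_imp_agrees[of mul] that by blast
  have sufficient: "M_ext_multiplication n zero x1 a mul \<and> ?G mul" if "\<exists>P. agrees mul P" for mul
    using agrees_sufficient that by blast
  \<comment> \<open>The three implications close a circle: graph condition, conditions (1) to (3),
    normal form, graph condition. Both the description of the set being counted and the stated
    equivalence follow propositionally.\<close>
  have "M_ext_multiplication n zero x1 a mul \<and> ?G mul \<longleftrightarrow> (\<exists>P. agrees mul P)" for mul
    using necessary[of mul] agrees[of mul] sufficient[of mul] by argo
  then have "{mul. M_ext_multiplication n zero x1 a mul \<and> ?G mul} = {mul. \<exists>P. agrees mul P}"
    by (rule Collect_cong)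
  note classes = card_isomorphism_classes[OF this]
  have "?G mul \<longleftrightarrow> ?C mul" if "M_ext_multiplication n zero x1 a mul" for mul
    using necessary[OF that] agrees[OF that] sufficient[of mul] by argo
  with classes show ?thesis
    unfolding Let_def by (intro conjI allI impI)
qed

end
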